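(* Let $\Gamma$ be a non-empty set of countable graphs, each containing an infinite path. Then for every infinite cardinal $\lambda$, $\mathrm{wcp}\,\mathrm{Forb}_\lambda(\Gamma)\ge\lambda^+$.
   Context: $\mathrm{Forb}(\Gamma)$ is the class of all graphs having no subgraph (not necessarily induced) isomorphic to a member of $\Gamma$, and $\mathrm{Forb}_\lambda(\Gamma)$ denotes the set of isomorphism types of members of $\mathrm{Forb}(\Gamma)$ with exactly $\lambda$ vertices. Write $G_1\le_w G_2$ if $G_1$ is isomorphic to a (not necessarily induced) subgraph of $G_2$. For a class $\mathcal K$ of graphs, the weak complexity $\mathrm{wcp}\,\mathcal K_\lambda$ is the least cardinality of a set $D$ of members of $\mathcal K$ with $\lambda$ vertices such that every member $G$ of $\mathcal K$ with $\lambda$ vertices satisfies $G\le_w G'$ for some $G'\in D$. *)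

theory Defs
  imports "HOL-Library.Countable_Set"
begin

unbundle cardinal_syntax

text \<open>A graph is a pair of a vertex set and a set of edges, an edge being a two-element set of
  vertices.\<close>

type_synonym 'a ugraph = "'a set \<times> 'a set set"

abbreviation verts :: "'a ugraph \<Rightarrow> 'a set" where
  "verts G \<equiv> fst G"

abbreviation edges :: "'a ugraph \<Rightarrow> 'a set set" where
  "edges G \<equiv> snd G"

definition graph :: "'a ugraph \<Rightarrow> bool" where
  "graph G \<longleftrightarrow> edges G \<subseteq> {{u, v} | u v. u \<in> verts G \<and> v \<in> verts G \<and> u \<noteq> v}"

definition subgraph :: "'a ugraph \<Rightarrow> 'a ugraph \<Rightarrow> bool" where
  "subgraph H G \<longleftrightarrow> graph H \<and> verts H \<subseteq> verts G \<and> edges H \<subseteq> edges G"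

definition isomorphic :: "'a ugraph \<Rightarrow> 'b ugraph \<Rightarrow> bool" where
  "isomorphic G H \<longleftrightarrow> (\<exists>f. bij_betw f (verts G) (verts H) \<and> edges H = (\<lambda>e. f ` e) ` edges G)"

definition weak_le :: "'a ugraph \<Rightarrow> 'b ugraph \<Rightarrow> bool" (infix "\<le>\<^sub>w" 50) where
  "G\<^sub>1 \<le>\<^sub>w G\<^sub>2 \<longleftrightarrow> (\<exists>H. subgraph H G\<^sub>2 \<and> isomorphic G\<^sub>1 H)"

definition has_infinite_path :: "'a ugraph \<Rightarrow> bool" where
  "has_infinite_path G \<longleftrightarrow>
     (\<exists>p :: nat \<Rightarrow> 'a. inj p \<and> range p \<subseteq> verts G \<and> (\<forall>n. {p n, p (Suc n)} \<in> edges G))"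

text \<open>The vertex type \<open>'a\<close> of the graphs under consideration is independent of the vertex type
  \<open>'b\<close> of the forbidden graphs.\<close>

definition Forb :: "'b ugraph set \<Rightarrow> 'a ugraph set" where
  "Forb \<Gamma> = {G. graph G \<and> (\<forall>H\<in>\<Gamma>. \<not> H \<le>\<^sub>w G)}"

text \<open>A cardinal \<open>\<kappa>\<close> is a cardinal order whose field consists of elements of the vertex type; hence
  every graph with \<open>\<kappa>\<close> vertices is isomorphic to one with vertices in \<open>'a\<close>.\<close>

definition of_size :: "'a ugraph set \<Rightarrow> 'a rel \<Rightarrow> 'a ugraph set" where
  "of_size K \<kappa> = {G \<in> K. |verts G| =o \<kappa>}"

definition weakly_dominating :: "'a ugraph set \<Rightarrow> 'a ugraph set \<Rightarrow> bool" where
  "weakly_dominating K D \<longleftrightarrow> D \<subseteq> K \<and> (\<forall>G\<in>K. \<exists>G'\<in>D. G \<le>\<^sub>w G')"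

text \<open>The weak complexity of a set of graphs, as a cardinal order: the least cardinality of a weakly
  dominating subset. Cardinal orders are determined only up to \<open>=o\<close>, hence the choice operator.\<close>

definition wcp :: "'a ugraph set \<Rightarrow> 'a ugraph rel" where
  "wcp K = (SOME c. \<exists>D. weakly_dominating K D \<and> c = |D| \<and>
                        (\<forall>D'. weakly_dominating K D' \<longrightarrow> |D| \<le>o |D'| ))"

lemma weak_le_refl:
  assumes "graph G"
  shows "G \<le>\<^sub>w G"
proof -
  have "isomorphic G G"
    unfolding isomorphic_def by (rule exI[of _ "\<lambda>x. x"]) (auto simp: bij_betw_def)
  with assms show ?thesis
    unfolding weak_le_def subgraph_def by blast
qed

lemma wcp_least:
  assumes "\<And>G. G \<in> K \<Longrightarrow> graph G"
  shows "\<exists>D. weakly_dominating K D \<and> wcp K = |D| \<and>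
             (\<forall>D'. weakly_dominating K D' \<longrightarrow> |D| \<le>o |D'| )"
proof -
  let ?S = "{ |D| | D. weakly_dominating K D}"
  have "weakly_dominating K K"
    using assms weak_le_refl unfolding weakly_dominating_def by blast
  then have "|K| \<in> ?S"
    by blast
  then obtain c where c: "c \<in> ?S" "\<And>d. (d, c) \<in> ordLess \<Longrightarrow> d \<notin> ?S"
    by (rule wfE_min[OF wf_ordLess]) blast
  then obtain D where D: "weakly_dominating K D" "c = |D|"
    by blast
  have "|D| \<le>o |D'|" if "weakly_dominating K D'" for D'
  proof -
    have "|D'| \<in> ?S"
      using that by blast
    then have "\<not> |D'| <o |D|"
      using c(2) D(2) by blast
    then show ?thesis
      using not_ordLess_iff_ordLeq[OF card_of_Well_order card_of_Well_order] by blast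
  qed
  with D(1) have "\<exists>c D. weakly_dominating K D \<and> c = |D| \<and>
                  (\<forall>D'. weakly_dominating K D' \<longrightarrow> |D| \<le>o |D'| )"
    by blast
  then show ?thesis
    unfolding wcp_def by (rule someI_ex)
qed

end

theory Submission
  imports Defs "HOL-Library.Sublist"
begin

text \<open>Rayless graphs lie in \<open>Forb \<Gamma>\<close>, and members of \<open>Forb \<Gamma>\<close> contain no infinite clique, since
  every countable graph embeds into one. Given at most \<open>\<kappa>\<close> members \<open>X\<close> of \<open>Forb \<Gamma>\<close> with \<open>\<kappa>\<close>
  vertices, let \<open>G\<close> be the disjoint union, over all \<open>X\<close>, of the comparability graphs of the trees of
  finite sequences of pairwise adjacent vertices of \<open>X\<close>. These trees have no infinite branch, so \<open>G\<close>
  is rayless. An embedding \<open>f\<close> of \<open>G\<close> into some \<open>X\<close> would yield an infinite clique of \<open>X\<close> by the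
  recursion \<open>x\<^sub>n = f (x\<^sub>0, \<dots>, x\<^sub>n\<^sub>-\<^sub>1)\<close>. Hence the given graphs are not weakly dominating.\<close>

section \<open>Embeddings, infinite paths and infinite cliques\<close>

lemma weak_le_imp_embedding:
  assumes "G \<le>\<^sub>w G'"
  obtains f where "inj_on f (verts G)" "f ` verts G \<subseteq> verts G'"
    "\<And>u v. {u, v} \<in> edges G \<Longrightarrow> {f u, f v} \<in> edges G'"
proof -
  obtain H f where H: "subgraph H G'" and f: "bij_betw f (verts G) (verts H)"
    "edges H = (\<lambda>e. f ` e) ` edges G"
    using assms unfolding weak_le_def isomorphic_def by blast
  show ?thesis
  proof
    show "inj_on f (verts G)"
      using f(1) by (rule bij_betw_imp_inj_on)
    show "f ` verts G \<subseteq> verts G'"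
      using f(1) H unfolding bij_betw_def subgraph_def by auto
    fix u v
    assume "{u, v} \<in> edges G"
    then have "f ` {u, v} \<in> edges H"
      using f(2) by blast
    then show "{f u, f v} \<in> edges G'"
      using H unfolding subgraph_def by auto
  qed
qed

lemma embedding_imp_weak_le:
  assumes "graph G" "inj_on f (verts G)" "f ` verts G \<subseteq> verts G'"
    "\<And>u v. {u, v} \<in> edges G \<Longrightarrow> {f u, f v} \<in> edges G'"
  shows "G \<le>\<^sub>w G'"
proof -
  let ?H = "(f ` verts G, (\<lambda>e. f ` e) ` edges G)"
  have edge: "\<exists>u v. e = {u, v} \<and> u \<in> verts G \<and> v \<in> verts G \<and> u \<noteq> v" if "e \<in> edges G" for e
    using that assms(1) unfolding graph_def by blast
  have "graph ?H"
    unfolding graph_def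
  proof
    fix e'
    assume "e' \<in> edges ?H"
    then obtain e where e: "e \<in> edges G" "e' = f ` e"
      by auto
    then obtain u v where "e = {u, v}" "u \<in> verts G" "v \<in> verts G" "u \<noteq> v"
      using edge by blast
    then show "e' \<in> {{u, v} |u v. u \<in> verts ?H \<and> v \<in> verts ?H \<and> u \<noteq> v}"
      using e assms(2) by (auto simp: inj_on_def)
  qed
  moreover have "edges ?H \<subseteq> edges G'"
    using assms(4) edge by fastforce
  ultimately have "subgraph ?H G'"
    using assms(3) unfolding subgraph_def by simp
  moreover have "isomorphic G ?H"
    unfolding isomorphic_def using assms(2) by (auto simp: bij_betw_def intro!: exI[of _ f])
  ultimately show ?thesis
    unfolding weak_le_def by blast
qed

lemma weak_le_infinite_path:
  assumes "H \<le>\<^sub>w G" "has_infinite_path H"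
  shows "has_infinite_path G"
proof -
  obtain f where f: "inj_on f (verts H)" "f ` verts H \<subseteq> verts G"
    "\<And>u v. {u, v} \<in> edges H \<Longrightarrow> {f u, f v} \<in> edges G"
    using assms(1) by (rule weak_le_imp_embedding) blast
  obtain p :: "nat \<Rightarrow> _" where p: "inj p" "range p \<subseteq> verts H" "\<And>n. {p n, p (Suc n)} \<in> edges H"
    using assms(2) unfolding has_infinite_path_def by blast
  have "inj (f \<circ> p)"
    using p(1,2) f(1) by (meson comp_inj_on inj_on_subset)
  then show ?thesis
    unfolding has_infinite_path_def using p f by (intro exI[of _ "f \<circ> p"]) fastforce
qed

lemma graph_edgeD:
  assumes "graph G" "{u, v} \<in> edges G"
  shows "u \<in> verts G" "v \<in> verts G" "u \<noteq> v"
proof -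
  obtain a b where "{u, v} = {a, b}" "a \<in> verts G" "b \<in> verts G" "a \<noteq> b"
    using assms unfolding graph_def by blast
  then show "u \<in> verts G" "v \<in> verts G" "u \<noteq> v"
    by (auto simp: doubleton_eq_iff)
qed

text \<open>Numbering the vertices of \<open>H\<close> and then applying \<open>x\<close> is an
  embedding: any two \<open>x i\<close>, \<open>x j\<close> with distinct indices are adjacent,
  hence distinct, so every edge is preserved.\<close>

lemma countable_weak_le_infinite_clique:
  fixes x :: "nat \<Rightarrow> 'a"
  assumes "graph H" "countable (verts H)" "graph G"
    and clique: "\<And>i j. i < j \<Longrightarrow> {x i, x j} \<in> edges G"
  shows "H \<le>\<^sub>w G"
proof (rule embedding_imp_weak_le)
  let ?c = "to_nat_on (verts H)"
  have adj: "{x i, x j} \<in> edges G" if "i \<noteq> j" for i j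
    using that clique[of i j] clique[of j i] by (cases i j rule: linorder_cases) (auto simp: insert_commute)
  have "inj x"
    using adj graph_edgeD(3)[OF assms(3)] by (meson injI)
  moreover have c: "inj_on ?c (verts H)"
    using assms(2) by (rule inj_on_to_nat_on)
  ultimately show "inj_on (x \<circ> ?c) (verts H)"
    by (meson comp_inj_on inj_on_subset subset_UNIV)
  have "x i \<in> verts G" for i
    using clique[of i "Suc i"] graph_edgeD(1)[OF assms(3)] by blast
  then show "(x \<circ> ?c) ` verts H \<subseteq> verts G"
    by auto
  show "{(x \<circ> ?c) u, (x \<circ> ?c) v} \<in> edges G" if "{u, v} \<in> edges H" for u v
    using adj[of "?c u" "?c v"] inj_onD[OF c] graph_edgeD[OF assms(1) that] by auto
qed (rule assms(1))

section \<open>Cardinality of the set of finite sequences\<close>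

text \<open>Each fixed length contributes at most \<open>|B|\<close> lists, by induction on the
  length; the infinite \<open>B\<close> absorbs the union over countably many lengths.\<close>

lemma card_of_lists_ordLeq_infinite:
  assumes inf: "infinite B" and le: "|A| \<le>o |B|"
  shows "|lists A| \<le>o |B|"
proof -
  define L where "L n = {xs \<in> lists A. length xs = n}" for n
  have "|L n| \<le>o |B|" for n
  proof (induction n)
    case 0
    have "L 0 = {[]}"
      unfolding L_def by auto
    then show ?case
      using inf by (metis card_of_ordLeq_infinite card_of_Well_order finite.emptyI finite_insert
          ordLeq_total)
  next
    case (Suc n)
    have "L (Suc n) = (\<lambda>(a, xs). a # xs) ` (A \<times> L n)"
      unfolding L_def by (auto simp: image_iff length_Suc_conv)
    then have "|L (Suc n)| \<le>o |A \<times> L n|"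
      using card_of_image by metis
    also have "|A \<times> L n| \<le>o |B|"
      using card_of_Sigma_ordLeq_infinite[OF inf le, of "\<lambda>_. L n"] Suc by blast
    finally show ?case .
  qed
  moreover have "lists A = (\<Union>n. L n)"
    unfolding L_def by auto
  ultimately show ?thesis
    using card_of_UNION_ordLeq_infinite[OF inf, of UNIV L] inf infinite_iff_card_of_nat[of B] by simp
qed

section \<open>Infinite branches from sequences of comparable lists\<close>

text \<open>If \<open>xs\<close> is a prefix of all late terms, injectivity makes still later terms
  proper extensions of \<open>xs\<close>, and comparability of neighbours keeps their next entry
  constant. So a common prefix can be lengthened forever.\<close>

lemma comparable_prefix_sequence_limit:
  fixes p :: "nat \<Rightarrow> 'a list"
  assumes "inj p"
    and comp: "\<And>n. prefix (p n) (p (Suc n)) \<or> prefix (p (Suc n)) (p n)"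
  obtains w where "\<And>L. \<exists>k. prefix (map w [0..<L]) (p k)"
proof -
  have step: "\<exists>a N'. \<forall>k\<ge>N'. prefix (xs @ [a]) (p k)" if xs: "\<forall>k\<ge>N. prefix xs (p k)" for xs N
  proof -
    have "finite {k. p k = xs}"
      using \<open>inj p\<close> finite_vimageI[of "{xs}" p] by (simp add: vimage_def)
    then obtain M where M: "\<And>k. p k = xs \<Longrightarrow> k \<le> M"
      by (meson finite_nat_set_iff_bounded_le mem_Collect_eq)
    define N' where "N' = max N (Suc M)"
    have long: "\<exists>a. prefix (xs @ [a]) (p k)" if k: "k \<ge> N'" for k
    proof -
      have "strict_prefix xs (p k)"
        using k xs M[of k] unfolding N'_def by (auto simp: strict_prefix_def)
      then obtain a zs where "p k = xs @ a # zs"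
        by (rule strict_prefixE')
      then show ?thesis
        by (auto simp: prefix_def)
    qed
    then obtain a where a: "prefix (xs @ [a]) (p N')"
      by blast
    have "prefix (xs @ [a]) (p k)" if "k \<ge> N'" for k
      using that
    proof (induction k rule: dec_induct)
      case (step n)
      obtain b where b: "prefix (xs @ [b]) (p (Suc n))"
        using long[of "Suc n"] step.hyps by auto
      \<comment> \<open>Both lists are prefixes of the longer of \<open>p n\<close> and
        \<open>p (Suc n)\<close>. Having equal length, they coincide.\<close>
      have "prefix (xs @ [a]) (xs @ [b]) \<or> prefix (xs @ [b]) (xs @ [a])"
        using comp[of n] step.IH b by (meson prefix_order.trans prefix_same_cases)
      then show ?case
        using b by auto
    qed (rule a)
    then show ?thesis
      by blast
  qed
  have "\<exists>xs N. length xs = L \<and> (\<forall>k\<ge>N. prefix xs (p k))" for L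
  proof (induction L)
    case (Suc L)
    then show ?case
      using step by (metis length_append_singleton)
  qed auto
  then obtain q N where q: "\<And>L. length (q L) = L" "\<And>L k. k \<ge> N L \<Longrightarrow> prefix (q L) (p k)"
    by metis
  \<comment> \<open>The lists \<open>q L\<close> are chosen separately for each \<open>L\<close>,
    but any two are prefixes of one common late term and therefore agree where both are
    defined.\<close>
  define w where "w i = q (Suc i) ! i" for i
  have "q L = map w [0..<L]" for L
  proof (rule nth_equalityI)
    fix i
    assume i: "i < length (q L)"
    define k where "k = max (N L) (N (Suc i))"
    have "prefix (q L) (p k)" "prefix (q (Suc i)) (p k)"
      using q(2) unfolding k_def by simp_all
    then have "take L (p k) = q L" "take (Suc i) (p k) = q (Suc i)"
      using q(1) by (metis prefix_def append_eq_conv_conj)+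
    then have "q L ! i = p k ! i" "q (Suc i) ! i = p k ! i"
      using q(1) i by (metis nth_take lessI)+
    then show "q L ! i = map w [0..<L] ! i"
      using i q(1) unfolding w_def by simp
  qed (simp add: q(1))
  then show ?thesis
    using that[of w] q(2) by (metis order_refl)
qed

section \<open>Clique trees: raylessness and embeddings\<close>

text \<open>The head of a list selects, via \<open>E\<close>, the graph in which the tail is a clique.\<close>

definition clique_lists :: "'a set \<Rightarrow> ('a \<Rightarrow> 'a ugraph) \<Rightarrow> 'a ugraph set \<Rightarrow> 'a list set" where
  "clique_lists U E D = {e # xs | e xs. e \<in> U \<and> xs \<in> lists U \<and> E e \<in> D \<and>
     (\<forall>i j. i < j \<longrightarrow> j < length xs \<longrightarrow> {xs ! i, xs ! j} \<in> edges (E e))}"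

text \<open>The injection \<open>h\<close> serves to have vertices of type \<open>'a\<close> rather than lists.\<close>

definition clique_tree :: "'a set \<Rightarrow> ('a list \<Rightarrow> 'a) \<Rightarrow> 'a list set \<Rightarrow> 'a ugraph" where
  "clique_tree V h T = (V, {{h xs, h ys} | xs ys. xs \<in> T \<and> ys \<in> T \<and> strict_prefix xs ys})"

lemma graph_clique_tree:
  assumes "inj_on h T" "h ` T \<subseteq> V"
  shows "graph (clique_tree V h T)"
proof -
  have "h xs \<noteq> h ys" if "xs \<in> T" "ys \<in> T" "strict_prefix xs ys" for xs ys
    using that assms(1) by (auto simp: strict_prefix_def dest: inj_onD)
  then show ?thesis
    unfolding clique_tree_def graph_def using assms(2) by auto blast
qed

text \<open>A ray would produce an infinite branch \<open>w\<close> of the tree; its head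
  \<open>w 0\<close> selects a member of \<open>D\<close> and the remaining entries form an infinite
  clique there.\<close>

lemma clique_tree_rayless:
  assumes h: "inj_on h (clique_lists U E D)"
    and no_clique: "\<And>X x. X \<in> D \<Longrightarrow> \<not> (\<forall>i j::nat. i < j \<longrightarrow> {x i, x j} \<in> edges X)"
  shows "\<not> has_infinite_path (clique_tree V h (clique_lists U E D))"
proof
  let ?T = "clique_lists U E D"
  assume "has_infinite_path (clique_tree V h ?T)"
  then obtain p :: "nat \<Rightarrow> 'a" where "inj p"
    and edge: "\<And>n. {p n, p (Suc n)} \<in> edges (clique_tree V h ?T)"
    unfolding has_infinite_path_def by blast
  have edge': "\<exists>xs ys. xs \<in> ?T \<and> ys \<in> ?T \<and> p n = h xs \<and> p (Suc n) = h ys \<and>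
      (prefix xs ys \<or> prefix ys xs)" for n
    using edge[of n] unfolding clique_tree_def by (auto simp: doubleton_eq_iff strict_prefix_def)
  \<comment> \<open>Pulling the path back along \<open>h\<close> gives an injective sequence of
    lists with comparable neighbours.\<close>
  define q where "q n = inv_into ?T h (p n)" for n
  have q: "q n \<in> ?T" "h (q n) = p n" for n
    using edge'[of n] h unfolding q_def by auto
  have "inj q"
    using \<open>inj p\<close> q(2) by (metis injD injI)
  moreover have "prefix (q n) (q (Suc n)) \<or> prefix (q (Suc n)) (q n)" for n
    using edge'[of n] h unfolding q_def by auto
  ultimately obtain w where w: "\<And>L. \<exists>k. prefix (map w [0..<L]) (q k)"
    by (rule comparable_prefix_sequence_limit) blast
  have branch: "E (w 0) \<in> D \<and> {w (Suc i), w (Suc j)} \<in> edges (E (w 0))" if "i < j" for i j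
  proof -
    \<comment> \<open>This length covers the head \<open>w 0\<close> and the tail up to its index
      \<open>j\<close>, which is \<open>w (Suc j)\<close>.\<close>
    obtain k where "prefix (map w [0..<Suc (Suc j)]) (q k)"
      using w by blast
    then obtain zs where zs: "q k = map w [0..<Suc (Suc j)] @ zs"
      unfolding prefix_def by blast
    obtain e xs where exs: "q k = e # xs" "E e \<in> D"
      "\<And>i j. i < j \<Longrightarrow> j < length xs \<Longrightarrow> {xs ! i, xs ! j} \<in> edges (E e)"
      using q(1)[of k] unfolding clique_lists_def by blast
    have nth: "(e # xs) ! i = w i" if "i < Suc (Suc j)" for i
      using that zs exs(1) by (simp add: nth_append del: upt_Suc)
    have "length (e # xs) \<ge> Suc (Suc j)"
      using zs exs(1) by (metis le_add1 length_append length_map length_upt minus_nat.diff_0)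
    then have "{xs ! i, xs ! j} \<in> edges (E e)"
      using exs(3) that by simp
    then show ?thesis
      using nth[of 0] nth[of "Suc i"] nth[of "Suc j"] that exs(2) by simp
  qed
  then show False
    using no_clique[of "E (w 0)" "w \<circ> Suc"] branch[of 0 1] by auto
qed

text \<open>Start at \<open>[e]\<close> and repeatedly append the image under \<open>f\<close> of
  the current list's vertex. Edges between the lists built so far make the appended vertices
  pairwise adjacent, which in turn keeps the next list in the tree.\<close>

lemma embedding_clique_tree_imp_clique:
  assumes e: "e \<in> U" "E e = X" "X \<in> D" and X: "graph X" "verts X \<subseteq> U"
    and f: "\<And>u v. {u, v} \<in> edges (clique_tree V h (clique_lists U E D)) \<Longrightarrow> {f u, f v} \<in> edges X"
      "f ` V \<subseteq> verts X"
    and h: "h ` clique_lists U E D \<subseteq> V"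
  shows "\<exists>x. \<forall>i j::nat. i < j \<longrightarrow> {x i, x j} \<in> edges X"
proof -
  let ?T = "clique_lists U E D"
  define s where "s = rec_nat [e] (\<lambda>_ xs. xs @ [f (h xs)])"
  define x where "x i = f (h (s i))" for i
  have s: "s n = e # map x [0..<n]" for n
    by (induction n) (simp_all add: s_def x_def)
  have prefix_s: "strict_prefix (s i) (s j)" if "i < j" for i j
  proof -
    have "s j = s i @ map x [i..<j]"
      using that s upt_add_eq_append[of 0 i "j - i"] by simp
    then show ?thesis
      using that by (auto simp: strict_prefix_def)
  qed
  have adj: "{x i, x j} \<in> edges X" if "i < j" "s i \<in> ?T" "s j \<in> ?T" for i j
    unfolding x_def using that prefix_s[OF that(1)] by (intro f(1)) (auto simp: clique_tree_def)
  have T: "s n \<in> ?T" for n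
  proof (induction n rule: less_induct)
    case (less n)
    have "x i \<in> U" if "i < n" for i
      using less[OF that] f(2) h X(2) unfolding x_def by blast
    moreover have "{x i, x j} \<in> edges X" if "i < j" "j < n" for i j
      using adj that less by auto
    ultimately show ?case
      unfolding s clique_lists_def using e by auto
  qed
  show ?thesis
    using adj T by blast
qed

section \<open>Families of at most \<open>\<kappa>\<close> graphs do not dominate\<close>

lemma not_weakly_dominating:
  fixes \<Gamma> :: "'b ugraph set" and \<kappa> :: "'a rel"
  assumes "\<Gamma> \<noteq> {}"
    and \<Gamma>: "\<forall>H\<in>\<Gamma>. graph H \<and> countable (verts H) \<and> has_infinite_path H"
    and \<kappa>: "Card_order \<kappa>" "infinite (Field \<kappa>)"
    and D: "D \<subseteq> of_size (Forb \<Gamma>) \<kappa>" "|D| \<le>o \<kappa>"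
  shows "\<not> weakly_dominating (of_size (Forb \<Gamma>) \<kappa>) D"
proof
  assume dom: "weakly_dominating (of_size (Forb \<Gamma>) \<kappa>) D"
  let ?V = "Field \<kappa>"
  have V: "\<kappa> =o |?V|"
    using card_of_Field_ordIso[OF \<kappa>(1)] by (rule ordIso_symmetric)
  \<comment> \<open>Heads of lists will be indices from \<open>?V\<close>, later entries vertices of
    members of \<open>D\<close>; \<open>U\<close> holds both and still has at most
    \<open>\<kappa>\<close> elements.\<close>
  define U where "U = ?V \<union> (\<Union>X\<in>D. verts X)"
  have DV: "|D| \<le>o |?V|"
    using D(2) V by (rule ordLeq_ordIso_trans)
  have X_graph: "graph X" if "X \<in> D" for X
    using that D(1) unfolding of_size_def Forb_def by blast
  have no_clique: "\<not> (\<forall>i j::nat. i < j \<longrightarrow> {x i, x j} \<in> edges X)" if "X \<in> D" for X x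
  proof
    assume "\<forall>i j. i < j \<longrightarrow> {x i, x j} \<in> edges X"
    moreover obtain H where "H \<in> \<Gamma>"
      using \<open>\<Gamma> \<noteq> {}\<close> by blast
    ultimately have "H \<le>\<^sub>w X"
      using \<Gamma> X_graph[OF that] by (blast intro: countable_weak_le_infinite_clique)
    then show False
      using \<open>H \<in> \<Gamma>\<close> that D(1) unfolding of_size_def Forb_def by blast
  qed
  have "|verts X| \<le>o |?V|" if "X \<in> D" for X
    using that D(1) V ordIso_transitive ordIso_imp_ordLeq unfolding of_size_def by blast
  then have "|\<Union>X\<in>D. verts X| \<le>o |?V|"
    using card_of_UNION_ordLeq_infinite[OF \<kappa>(2) DV] by blast
  then have "|U| \<le>o |?V|"
    unfolding U_def
    using card_of_Un_ordLeq_infinite_Field[OF _ _ _ card_of_Card_order, of ?V ?V] \<kappa>(2)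
      ordIso_imp_ordLeq[OF card_of_refl] unfolding Field_card_of by blast
  then have "|lists U| \<le>o |?V|"
    by (rule card_of_lists_ordLeq_infinite[OF \<kappa>(2)])
  then obtain h where h: "inj_on h (lists U)" "h ` lists U \<subseteq> ?V"
    unfolding card_of_ordLeq[symmetric] by blast
  \<comment> \<open>Indexing \<open>D\<close> by elements of \<open>?V\<close>, possibly with
    repetitions, lets a list entry name a graph.\<close>
  obtain E where E: "D \<subseteq> E ` ?V"
  proof (cases "D = {}")
    case True
    then show ?thesis
      using that by simp
  next
    case False
    then obtain E where "E ` ?V = D"
      using iffD2[OF card_of_ordLeq2 DV] by blast
    then show ?thesis
      using that[of E] by simp
  qed
  let ?T = "clique_lists U E D"
  let ?G = "clique_tree ?V h ?T"
  have TU: "?T \<subseteq> lists U"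
    unfolding clique_lists_def by auto
  then have hT: "inj_on h ?T" "h ` ?T \<subseteq> ?V"
    using h by (blast intro: inj_on_subset)+
  have "\<not> has_infinite_path ?G"
    using hT(1) no_clique by (rule clique_tree_rayless)
  then have "?G \<in> Forb \<Gamma>"
    unfolding Forb_def using graph_clique_tree[OF hT] \<Gamma> weak_le_infinite_path by blast
  then have "?G \<in> of_size (Forb \<Gamma>) \<kappa>"
    unfolding of_size_def using card_of_Field_ordIso[OF \<kappa>(1)] by (simp add: clique_tree_def)
  then obtain X where X: "X \<in> D" "?G \<le>\<^sub>w X"
    using dom unfolding weakly_dominating_def by blast
  obtain f where f: "f ` verts ?G \<subseteq> verts X"
    "\<And>u v. {u, v} \<in> edges ?G \<Longrightarrow> {f u, f v} \<in> edges X"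
    using X(2) by (rule weak_le_imp_embedding) blast
  obtain e where e: "e \<in> U" "E e = X"
    using E X(1) unfolding U_def by blast
  have "verts X \<subseteq> U" "f ` ?V \<subseteq> verts X"
    using X(1) f(1) unfolding U_def clique_tree_def by auto
  with e X(1) X_graph f(2) hT(2) have "\<exists>x. \<forall>i j::nat. i < j \<longrightarrow> {x i, x j} \<in> edges X"
    by (intro embedding_clique_tree_imp_clique) auto
  then show False
    using no_clique[OF X(1)] by blast
qed

theorem theorem1p7:
  fixes \<Gamma> :: "'b ugraph set" and \<kappa> :: "'a rel"
  assumes "\<Gamma> \<noteq> {}"
    and "\<forall>H\<in>\<Gamma>. graph H \<and> countable (verts H) \<and> has_infinite_path H"
    and "Card_order \<kappa>" and "infinite (Field \<kappa>)"
  shows "cardSuc \<kappa> \<le>o wcp (of_size (Forb \<Gamma>) \<kappa>)"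
proof -
  let ?K = "of_size (Forb \<Gamma>) \<kappa>"
  have "graph G" if "G \<in> ?K" for G
    using that unfolding of_size_def Forb_def by blast
  then obtain D where D: "weakly_dominating ?K D" "wcp ?K = |D|"
    using wcp_least[of ?K] by blast
  \<comment> \<open>The minimum defining \<open>wcp\<close> is attained by \<open>D\<close>, so
    excluding dominating families of size at most \<open>\<kappa>\<close> suffices.\<close>
  then have "\<not> |D| \<le>o \<kappa>"
    using not_weakly_dominating[OF assms] unfolding weakly_dominating_def by blast
  then have "\<kappa> <o |D|"
    using not_ordLeq_iff_ordLess[OF card_order_on_well_order_on[OF assms(3)] card_of_Well_order]
    by blast
  then show ?thesis
    unfolding D(2) cardSuc_ordLess_ordLeq[OF assms(3) card_of_Card_order] .
qed

end
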